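(* Let $Z$ be a real normed space whose dual $Y=Z'$ has finite dimension, $E$ a normed space, and $X\subset Y$ a convex set that is either closed and unbounded, or open. Let $K\subset X$ be closed and bounded, let $g\colon X\to\mathbb R$ satisfy the conditions $(g_0)$ and $(g_1)$ given in the context, and let $h(t,u):=g(u)-[g(t)+\langle g'(t),u-t\rangle]$ for $t\in K$, $u\in X$. For each $n\ge1$ let $L_n\colon D(L_n)\to\mathcal F(K;E)$ be a linear operator dominated by a positive linear operator $S_n\colon D(S_n)\to\mathcal F(K)$, with $\mathcal C(X;E,g)\subset D(L_n)$ and $\mathcal C(X,g)\subset D(S_n)$. Assume that $\psi_t^2\in\mathcal C(X,g)$ for some (and hence for all) $t\in Y$, and put $\gamma_n^2(t):=S_n(\psi_t^2)(t)$, $\gamma_n(t)\ge0$. If $K$ is convex and $K_1\subset\overset{\circ}{K}$ is a closed subset, then for any $F\in\mathcal C(X;E,g)$ there exists a constant $M>0$, depending only on $F$, $K$, $K_1$ and $g$ (in particular not on $n$, $\delta$, $t$ or the operators), such that for all $n\ge 1$, $\delta>0$ and $t\in K_1$ $$\|L_n(F)(t)-F(t)\|\le\|L_n(F(t))(t)-F(t)\|+\omega(F,\delta)\bigl(S_n(\mathbf 1)(t)+\delta^{-2}S_n(\psi_t^2)(t)\bigr)+M\,S_n(h(t,\cdot))(t),$$ where $\omega(F,\cdot)$ is the modulus of continuity of $F$ on $K$ and $L_n(F(t))$ is $L_n$ applied to the constant mapping with value $F(t)$. When $L_n$ preserves the constants and $S_n(\mathbf 1)(t)=1$, the estimate becomes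 $$\|L_n(F)(t)-F(t)\|\le 2\,\omega(F,\gamma_n(t))+M\,S_n(h(t,\cdot))(t).$$ Finally, if (in addition) $S_n$ preserves the linear functionals, i.e. $S_n(\phi_{|X})(t)=\phi(t)$ for all linear functionals $\phi$ on $Y$, then $$\|L_n(F)(t)-F(t)\|\le 2\,\omega(F,\gamma_n(t))+M\,(S_n(g)(t)-g(t)).$$ In case $\dim(Y)=1$ (so $Y$ is identified with $\mathbb R$), $X=[a,+\infty[$ and $K=[a,b]$, the previous estimates hold with $K_1=[a,b_1]$ for any $b_1<b$; respectively, if $X=\,]-\infty,b]$ and $K=[a,b]$, they hold with $K_1=[a_1,b]$ for any $a_1>a$.
   Context: $\mathcal F(X;E)$: all mappings $X\to E$; $\mathcal C(X;E)$: the continuous ones. For strictly positive $g\colon X\to\mathbb R$, $\mathcal C(X;E,g)$ is the set of $F\in\mathcal C(X;E)$ for which there is $M>0$ with $\|F(u)\|\le Mg(u)$ for all $u\in X$. For $E=\mathbb R$ one omits $E$: $\mathcal F(X)$, $\mathcal C(X)$, $\mathcal C(X,g)$. $\|F\|$ denotes the function $u\mapsto\|F(u)\|$. Constant mappings are denoted by their value; $\mathbf 1$ is the constant function $1$. For $t\in Y$, $\psi_t\colon X\to\mathbb R$ is $\psi_t(u):=\|u-t\|$. $\overset{\circ}{K}$ is the interior of $K$. (As $Y$ is finite-dimensional, the *weak topology $\sigma(Y,Z)$ coincides with the norm topology.) Conditions on $g$ (in finite dimension): $(g_0)$ $g$ is strictly positive, strictly convex and continuous on $X$, and Fréchet differentiable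 on $K$ (differentiability at points of $K$ being relative to $X$), with $g'\colon K\to Y'$ continuous. $(g_1)$ For every $n\ge1$ there exists a closed, convex and bounded subset $B_n$ of $X$ containing $K$ (closed in $Y$) such that $g(t)\ge n$ for every $t\in X\setminus B_n$. If $X$ is unbounded, additionally $\lim_{\|t\|\to\infty,\ t\in X} g(t)/\|t\|=+\infty$. Operators: $D(L)$, $D(S)$ are linear subspaces of $\mathcal C(X;E)$ and $\mathcal C(X)$, and $L\colon D(L)\to\mathcal F(K;E)$, $S\colon D(S)\to\mathcal F(K)$ are linear. $S$ is positive if $f\in D(S)$, $f\ge 0$ imply $S(f)\ge0$. $L$ is dominated by $S$ if for all $F\in D(L)$ one has $\|F\|\in D(S)$ and $\|L(F)(t)\|\le S(\|F\|)(t)$ for all $t\in K$. $L$ preserves the constants if for every $c\in E$ one has $c\in D(L)$ and $L(c)(t)=c$ for all $t\in K$. Modulus of continuity on $K$: $\omega(F,r):=\sup\{\|F(u)-F(t)\| : t,u\in K,\ \|t-u\|\le r\}$ for $r\ge0$ (so $\omega(F,0)=0$). *)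

theory Defs
  imports "HOL-Analysis.Analysis"
begin

text \<open>
  A mapping defined on a set \<open>X\<close> is an element of \<open>extensional X\<close>, so that two mappings on
  \<open>X\<close> are equal iff they agree on \<open>X\<close>; concrete ones are written \<open>\<lambda>u\<in>X. \<dots>\<close>.
  An operator with values in the mappings on \<open>K\<close> is a function whose values \<open>L F t\<close> are
  only ever constrained or used for \<open>t \<in> K\<close>.
\<close>

definition strictly_convex_on :: "'a::real_vector set \<Rightarrow> ('a \<Rightarrow> real) \<Rightarrow> bool" where
  "strictly_convex_on X g \<longleftrightarrow> convex X \<and>
     (\<forall>x\<in>X. \<forall>y\<in>X. \<forall>s. x \<noteq> y \<and> 0 < s \<and> s < 1 \<longrightarrow>
        g ((1 - s) *\<^sub>R x + s *\<^sub>R y) < (1 - s) * g x + s * g y)"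

definition continuous_maps ::
    "'a::topological_space set \<Rightarrow> ('a \<Rightarrow> 'e::topological_space) set" where
  "continuous_maps X = {F \<in> extensional X. continuous_on X F}"

definition weighted_maps ::
    "'a::topological_space set \<Rightarrow> ('a \<Rightarrow> real) \<Rightarrow> ('a \<Rightarrow> 'e::real_normed_vector) set" where
  "weighted_maps X g = {F \<in> continuous_maps X. \<exists>M>0. \<forall>u\<in>X. norm (F u) \<le> M * g u}"

definition map_subspace ::
    "'a::topological_space set \<Rightarrow> ('a \<Rightarrow> 'e::real_normed_vector) set \<Rightarrow> bool" where
  "map_subspace X D \<longleftrightarrow> D \<subseteq> continuous_maps X \<and> (\<lambda>u\<in>X. 0) \<in> D \<and>
     (\<forall>F\<in>D. \<forall>G\<in>D. (\<lambda>u\<in>X. F u + G u) \<in> D) \<and>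
     (\<forall>F\<in>D. \<forall>c. (\<lambda>u\<in>X. c *\<^sub>R F u) \<in> D)"

definition linear_operator ::
    "'a::topological_space set \<Rightarrow> 'a set \<Rightarrow> ('a \<Rightarrow> 'e::real_normed_vector) set
      \<Rightarrow> (('a \<Rightarrow> 'e) \<Rightarrow> 'a \<Rightarrow> 'e) \<Rightarrow> bool" where
  "linear_operator X K D L \<longleftrightarrow> map_subspace X D \<and>
     (\<forall>F\<in>D. \<forall>G\<in>D. \<forall>t\<in>K. L (\<lambda>u\<in>X. F u + G u) t = L F t + L G t) \<and>
     (\<forall>F\<in>D. \<forall>c. \<forall>t\<in>K. L (\<lambda>u\<in>X. c *\<^sub>R F u) t = c *\<^sub>R L F t)"

definition positive_operator ::
    "'a set \<Rightarrow> 'a set \<Rightarrow> ('a \<Rightarrow> real) set \<Rightarrow> (('a \<Rightarrow> real) \<Rightarrow> 'a \<Rightarrow> real) \<Rightarrow> bool" where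
  "positive_operator X K D S \<longleftrightarrow>
     (\<forall>f\<in>D. (\<forall>u\<in>X. 0 \<le> f u) \<longrightarrow> (\<forall>t\<in>K. 0 \<le> S f t))"

definition dominated_by ::
    "'a set \<Rightarrow> 'a set \<Rightarrow> ('a \<Rightarrow> 'e::real_normed_vector) set \<Rightarrow> (('a \<Rightarrow> 'e) \<Rightarrow> 'a \<Rightarrow> 'e)
      \<Rightarrow> ('a \<Rightarrow> real) set \<Rightarrow> (('a \<Rightarrow> real) \<Rightarrow> 'a \<Rightarrow> real) \<Rightarrow> bool" where
  "dominated_by X K DL L DS S \<longleftrightarrow>
     (\<forall>F\<in>DL. (\<lambda>u\<in>X. norm (F u)) \<in> DS \<and>
        (\<forall>t\<in>K. norm (L F t) \<le> S (\<lambda>u\<in>X. norm (F u)) t))"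

definition preserves_constants ::
    "'a set \<Rightarrow> 'a set \<Rightarrow> ('a \<Rightarrow> 'e) set \<Rightarrow> (('a \<Rightarrow> 'e) \<Rightarrow> 'a \<Rightarrow> 'e) \<Rightarrow> bool" where
  "preserves_constants X K D L \<longleftrightarrow> (\<forall>c. (\<lambda>u\<in>X. c) \<in> D \<and> (\<forall>t\<in>K. L (\<lambda>u\<in>X. c) t = c))"

definition modulus_on ::
    "'a::real_normed_vector set \<Rightarrow> ('a \<Rightarrow> 'e::real_normed_vector) \<Rightarrow> real \<Rightarrow> real" where
  "modulus_on K F r = Sup {norm (F u - F t) | t u. t \<in> K \<and> u \<in> K \<and> norm (t - u) \<le> r}"

text \<open>
  The derivative relative to \<open>X\<close> need not be unique as a functional on the whole space when
  \<open>X\<close> has empty interior, so the chosen \<open>g'\<close> is part of the data.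
\<close>

definition cond_g0 ::
    "'a::real_normed_vector set \<Rightarrow> 'a set \<Rightarrow> ('a \<Rightarrow> real) \<Rightarrow> ('a \<Rightarrow> 'a \<Rightarrow>\<^sub>L real) \<Rightarrow> bool" where
  "cond_g0 X K g g' \<longleftrightarrow>
     (\<forall>u\<in>X. 0 < g u) \<and> strictly_convex_on X g \<and> continuous_on X g \<and>
     (\<forall>t\<in>K. (g has_derivative blinfun_apply (g' t)) (at t within X)) \<and>
     continuous_on K g'"

definition cond_g1 :: "'a::real_normed_vector set \<Rightarrow> 'a set \<Rightarrow> ('a \<Rightarrow> real) \<Rightarrow> bool" where
  "cond_g1 X K g \<longleftrightarrow>
     (\<forall>n::nat. 1 \<le> n \<longrightarrow>
        (\<exists>B. closed B \<and> convex B \<and> bounded B \<and> B \<subseteq> X \<and> K \<subseteq> B \<and>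
             (\<forall>t\<in>X - B. real n \<le> g t))) \<and>
     (\<not> bounded X \<longrightarrow>
        filterlim (\<lambda>t. g t / norm t) at_top (inf at_infinity (principal X)))"

definition h_fun ::
    "('a::real_normed_vector \<Rightarrow> real) \<Rightarrow> ('a \<Rightarrow> 'a \<Rightarrow>\<^sub>L real) \<Rightarrow> 'a \<Rightarrow> 'a \<Rightarrow> real" where
  "h_fun g g' t u = g u - (g t + blinfun_apply (g' t) (u - t))"

definition dominated_pair ::
    "'a::topological_space set \<Rightarrow> 'a set \<Rightarrow> ('a \<Rightarrow> real)
      \<Rightarrow> ('a \<Rightarrow> 'e::real_normed_vector) set \<Rightarrow> (('a \<Rightarrow> 'e) \<Rightarrow> 'a \<Rightarrow> 'e)
      \<Rightarrow> ('a \<Rightarrow> real) set \<Rightarrow> (('a \<Rightarrow> real) \<Rightarrow> 'a \<Rightarrow> real) \<Rightarrow> bool" where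
  "dominated_pair X K g DL L DS S \<longleftrightarrow>
     linear_operator X K DL L \<and> weighted_maps X g \<subseteq> DL \<and>
     linear_operator X K DS S \<and> weighted_maps X g \<subseteq> DS \<and>
     positive_operator X K DS S \<and> dominated_by X K DL L DS S"

text \<open>A linear isometry from the real line onto the space; it exists only in dimension one.\<close>

definition real_identification :: "(real \<Rightarrow> 'a::real_normed_vector) \<Rightarrow> bool" where
  "real_identification \<iota> \<longleftrightarrow> linear \<iota> \<and> surj \<iota> \<and> (\<forall>x. norm (\<iota> x) = \<bar>x\<bar>)"

end

theory Submission
  imports Defs
begin

text \<open>
  For fixed \<open>t\<close> the function \<open>h t\<close> is convex, vanishes at \<open>t\<close> and is positive elsewhere, so it is
  bounded below by some \<open>c > 0\<close> on the pairs of points of \<open>K\<close> at distance \<open>\<rho>\<close>, and by convexity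
  it grows at least linearly along the rays from \<open>K1\<close> beyond that distance. Hence \<open>g \<le> C h t\<close> and
  \<open>norm (F u - F t) \<le> M h t u\<close> for \<open>t\<close> in \<open>K1\<close> and \<open>u\<close> outside \<open>K\<close>, while inside \<open>K\<close> the
  increments of \<open>F\<close> along a segment are bounded through the modulus of continuity. Applying the
  positive operator \<open>S\<close> to the resulting pointwise bound gives the estimates.
\<close>

section \<open>Compactness in finite-dimensional normed spaces\<close>

text \<open>Finite dimension is only given through a finite spanning set, so Heine-Borel is proved
  by induction on that set. A new vector \<open>x\<close> outside \<open>span B\<close> has positive
  distance from it, which bounds the coefficient of \<open>x\<close> for every vector of the ball;
  the ball is then a closed subset of the continuous image of a compact product.\<close>

lemma compact_cball_Int_span:
  fixes B :: "'a::real_normed_vector set"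
  assumes "finite B"
  shows "compact (cball 0 r \<inter> span B)"
  using assms
proof (induction B arbitrary: r rule: finite_induct)
  case empty
  have "compact (cball (0::'a) r \<inter> {0})"
    by (intro finite_imp_compact) auto
  then show ?case by simp
next
  case (insert x B)
  show ?case
  proof (cases "x \<in> span B")
    case True
    then show ?thesis using insert.IH by (simp add: span_redundant)
  next
    case False
    \<comment> \<open>A convergent sequence is bounded, so it stays in one of the balls that the
      induction hypothesis makes compact, and so does its limit.\<close>
    have "closed (span B)"
      unfolding closed_sequential_limits
    proof (intro allI impI, elim conjE)
      fix s l assume s: "\<forall>n. s n \<in> span B" "s \<longlonglongrightarrow> l"
      obtain R where "\<And>n. norm (s n) \<le> R"
        using convergent_imp_Bseq[OF convergentI[OF s(2)]] by (auto simp: Bseq_def)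
      then have "\<forall>n. s n \<in> cball 0 R \<inter> span B" using s by auto
      then have "l \<in> cball 0 R \<inter> span B"
        using compact_imp_closed[OF insert.IH[of R]] s(2)
        unfolding closed_sequential_limits by blast
      then show "l \<in> span B" by simp
    qed
    then have d: "infdist x (span B) > 0" (is "?d > 0")
      using False infdist_pos_not_in_closed[of "span B" x] span_zero by blast
    \<comment> \<open>\<open>r / ?d\<close> will bound the coefficient of \<open>x\<close>, and
      \<open>R\<close> the norm of what remains once that multiple of \<open>x\<close> is
      subtracted.\<close>
    define R where "R = r + r / ?d * norm x"
    let ?f = "\<lambda>(k, s). k *\<^sub>R x + s"
    let ?C = "?f ` ({- (r / ?d)..r / ?d} \<times> (cball 0 R \<inter> span B))"
    have "compact ?C"
      by (intro compact_continuous_image compact_Times insert.IH compact_Icc)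
        (auto simp: case_prod_beta intro!: continuous_intros)
    moreover have "cball 0 r \<inter> span (insert x B) = cball 0 r \<inter> ?C"
    proof (intro equalityI subsetI)
      fix y assume y: "y \<in> cball 0 r \<inter> span (insert x B)"
      then obtain k where k: "y - k *\<^sub>R x \<in> span B" by (auto simp: span_breakdown_eq)
      have "\<bar>k\<bar> * ?d \<le> norm y"
      proof (cases "k = 0")
        case False
        \<comment> \<open>Subtracting this vector from \<open>x\<close> gives \<open>y / k\<close>,
          so the norm of \<open>y / k\<close> is at least the distance of \<open>x\<close> from
          \<open>span B\<close>.\<close>
        have "- ((1 / k) *\<^sub>R (y - k *\<^sub>R x)) \<in> span B"
          using k by (intro span_neg span_scale)
        moreover have "dist x (- ((1 / k) *\<^sub>R (y - k *\<^sub>R x))) = norm y / \<bar>k\<bar>"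
          using False by (simp add: dist_norm algebra_simps divide_inverse_commute)
        ultimately have "?d \<le> norm y / \<bar>k\<bar>" by (metis infdist_le)
        then show ?thesis using False by (simp add: field_simps)
      qed simp
      then have kr: "\<bar>k\<bar> \<le> r / ?d" using y d by (simp add: field_simps)
      have "norm (y - k *\<^sub>R x) \<le> norm y + \<bar>k\<bar> * norm x"
        using norm_triangle_ineq4[of y "k *\<^sub>R x"] by simp
      also have "\<dots> \<le> R"
        unfolding R_def using y kr by (intro add_mono mult_right_mono) auto
      finally have "(k, y - k *\<^sub>R x) \<in> {- (r / ?d)..r / ?d} \<times> (cball 0 R \<inter> span B)"
        using k kr by auto
      then have "?f (k, y - k *\<^sub>R x) \<in> ?C" by (rule imageI)
      then show "y \<in> cball 0 r \<inter> ?C" using y by simp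
    next
      fix y assume "y \<in> cball 0 r \<inter> ?C"
      then obtain k b where "y \<in> cball 0 r" "y = k *\<^sub>R x + b" "b \<in> span B" by auto
      moreover from this have "y - k *\<^sub>R x \<in> span B" by simp
      ultimately show "y \<in> cball 0 r \<inter> span (insert x B)"
        using span_breakdown_eq[of y x B] by blast
    qed
    ultimately show ?thesis by (simp add: closed_Int_compact)
  qed
qed

lemma compact_if_closed_bounded_finite_span:
  fixes C :: "'a::real_normed_vector set"
  assumes "\<exists>B::'a set. finite B \<and> span B = UNIV" "closed C" "bounded C"
  shows "compact C"
proof -
  obtain B :: "'a set" where B: "finite B" "span B = UNIV" using assms(1) by blast
  obtain r where "C \<subseteq> cball 0 r" using assms(3) by (auto simp: bounded_iff subset_iff)
  then have "C = C \<inter> (cball 0 r \<inter> span B)" using B by auto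
  then show ?thesis
    using closed_Int_compact[OF assms(2) compact_cball_Int_span[OF B(1)]] by metis
qed

section \<open>Strict convexity and the function h\<close>

lemma strictly_convex_on_less:
  assumes "strictly_convex_on X g" "x \<in> X" "y \<in> X" "x \<noteq> y" "0 < s" "s < 1"
  shows "g ((1 - s) *\<^sub>R x + s *\<^sub>R y) < (1 - s) * g x + s * g y"
  using assms unfolding strictly_convex_on_def by blast

lemma strictly_convex_on_imp_convex_on:
  assumes "strictly_convex_on X g"
  shows "convex_on X g"
proof (rule convex_onI)
  show "convex X" using assms by (simp add: strictly_convex_on_def)
next
  fix s x y assume "0 < s" "s < (1::real)" "x \<in> X" "y \<in> X"
  then show "g ((1 - s) *\<^sub>R x + s *\<^sub>R y) \<le> (1 - s) * g x + s * g y"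
    using strictly_convex_on_less[OF assms, of x y s]
    by (cases "x = y") (auto simp: algebra_simps)
qed

text \<open>By convexity the difference quotients of \<open>g\<close> along the segment from
  \<open>t\<close> to \<open>u\<close> stay below \<open>g u - g t\<close>, and their limit at
  \<open>t\<close> is the derivative in the direction \<open>u - t\<close>.\<close>

lemma h_fun_nonneg:
  assumes g: "convex_on X g" and "t \<in> X" "u \<in> X"
    and deriv: "(g has_derivative blinfun_apply (g' t)) (at t within X)"
  shows "0 \<le> h_fun g g' t u"
proof -
  have "convex X" using g by (rule convex_on_imp_convex)
  let ?p = "\<lambda>s::real. t + s *\<^sub>R (u - t)"
  have p: "?p s \<in> X" if "0 \<le> s" "s \<le> 1" for s
    using convexD_alt[OF \<open>convex X\<close> assms(2,3) that] by (simp add: algebra_simps)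
  have "(?p has_derivative (\<lambda>s. s *\<^sub>R (u - t))) (at 0 within {0..1})"
    by (auto intro!: derivative_eq_intros)
  \<comment> \<open>The derivative is relative to \<open>X\<close>; it passes to the segment because
    convexity keeps the segment inside \<open>X\<close>.\<close>
  moreover have "(g has_derivative blinfun_apply (g' t)) (at (?p 0) within ?p ` {0..1})"
    using has_derivative_subset[OF deriv, of "?p ` {0..1}"] p by fastforce
  ultimately have "(g \<circ> ?p has_derivative blinfun_apply (g' t) \<circ> (\<lambda>s. s *\<^sub>R (u - t)))
      (at 0 within {0..1})"
    by (rule diff_chain_within)
  then have "(g \<circ> ?p has_field_derivative g' t (u - t)) (at 0 within {0..1})"
    unfolding has_field_derivative_def
    by (rule has_derivative_eq_rhs) (auto simp: fun_eq_iff blinfun.scaleR_right)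
  then have lim: "((\<lambda>s. (g (?p s) - g t) / s) \<longlongrightarrow> g' t (u - t)) (at 0 within {0..1})"
    by (simp add: has_field_derivative_iff o_def)
  have "g' t (u - t) \<le> g u - g t"
  proof (rule tendsto_upperbound[OF lim])
    show "\<forall>\<^sub>F s in at 0 within {0..1}. (g (?p s) - g t) / s \<le> g u - g t"
      unfolding eventually_at_filter
    proof (intro always_eventually allI impI)
      fix s :: real assume s: "s \<noteq> 0" "s \<in> {0..1}"
      have "g (?p s) \<le> (1 - s) * g t + s * g u"
        using convex_onD[OF g, of s t u] s assms(2,3) by (simp add: algebra_simps)
      then show "(g (?p s) - g t) / s \<le> g u - g t"
        using s by (simp add: field_simps)
    qed
    show "at (0::real) within {0..1} \<noteq> bot"
      by (simp add: trivial_limit_within islimpt_Icc)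
  qed
  then show ?thesis by (simp add: h_fun_def)
qed

text \<open>\<open>h_fun g g' t\<close> differs from \<open>g\<close> by an affine function and
  vanishes at \<open>t\<close>, so the convexity inequality loses its term at \<open>t\<close>. Read
  backwards, this is linear growth along rays from \<open>t\<close>.\<close>

lemma h_fun_convex:
  assumes "convex_on X g" "t \<in> X" "u \<in> X" "0 \<le> s" "s \<le> 1"
  shows "h_fun g g' t (t + s *\<^sub>R (u - t)) \<le> s * h_fun g g' t u"
proof -
  have "g (t + s *\<^sub>R (u - t)) \<le> (1 - s) * g t + s * g u"
    using convex_onD[OF assms(1), of s t u] assms by (simp add: algebra_simps)
  moreover have "g' t (t + s *\<^sub>R (u - t) - t) = s * g' t (u - t)"
    by (simp add: blinfun.scaleR_right)
  ultimately show ?thesis unfolding h_fun_def by (simp add: algebra_simps)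
qed

text \<open>At the midpoint \<open>v\<close> of \<open>t\<close> and \<open>u\<close>, strict
  convexity makes h less than half its value at \<open>u\<close>, while the tangent inequality keeps
  it nonnegative.\<close>

lemma h_fun_pos:
  assumes g: "strictly_convex_on X g" and "t \<in> X" "u \<in> X" "u \<noteq> t"
    and deriv: "(g has_derivative blinfun_apply (g' t)) (at t within X)"
  shows "0 < h_fun g g' t u"
proof -
  note cvx = strictly_convex_on_imp_convex_on[OF g]
  define v where "v = (1 - 1/2) *\<^sub>R t + (1/2::real) *\<^sub>R u"
  have "v \<in> X"
    unfolding v_def by (rule convexD_alt[OF convex_on_imp_convex[OF cvx]]) (use assms in auto)
  then have "0 \<le> h_fun g g' t v" by (intro h_fun_nonneg[OF cvx] assms)
  moreover have "g v < (1 - 1/2) * g t + (1/2) * g u"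
    unfolding v_def by (intro strictly_convex_on_less[OF g]) (use assms in auto)
  moreover have "g' t (v - t) = (1/2) * g' t (u - t)"
    unfolding v_def by (simp add: blinfun.diff_right blinfun.add_right blinfun.scaleR_right)
  ultimately show ?thesis by (simp add: h_fun_def)
qed

text \<open>Joint continuity in both points is what allows a lower bound for h that is uniform in
  \<open>t\<close>.\<close>

lemma continuous_on_h_fun:
  assumes "continuous_on K g" "continuous_on K g'"
  shows "continuous_on (K \<times> K) (\<lambda>p. h_fun g g' (fst p) (snd p))"
  unfolding h_fun_def
  by (intro continuous_intros continuous_on_compose2[OF assms(1)]
      continuous_on_compose2[OF assms(2)]) auto

section \<open>Position of K1 inside K\<close>

text \<open>
  Besides the convexity of \<open>K\<close>, this is the only geometric property that the three cases for
  \<open>K1\<close> share and that the estimate needs.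
\<close>

definition collar :: "'a::real_normed_vector set \<Rightarrow> 'a set \<Rightarrow> 'a set \<Rightarrow> real \<Rightarrow> bool" where
  "collar X K K1 \<rho> \<longleftrightarrow> 0 < \<rho> \<and> K1 \<subseteq> K \<and>
     (\<forall>t\<in>K1. \<forall>u\<in>X - K. \<rho> \<le> norm (u - t) \<and> t + (\<rho> / norm (u - t)) *\<^sub>R (u - t) \<in> K)"

text \<open>A compact subset of an open set has closed balls of one common radius \<rho> around its
  points inside that set. A point outside \<open>K\<close> is then outside the ball, and the segment
  to it meets the sphere of radius \<rho> within \<open>K\<close>.\<close>

lemma collar_interior:
  assumes "compact K1" "K1 \<subseteq> interior K"
  shows "\<exists>\<rho>. collar X K K1 \<rho>"
proof -
  obtain \<rho> where \<rho>: "0 < \<rho>" "(\<Union>t\<in>K1. cball t \<rho>) \<subseteq> interior K"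
    using compact_subset_open_imp_cball_epsilon_subset[OF assms(1) open_interior assms(2)] by blast
  have sub: "cball t \<rho> \<subseteq> K" if "t \<in> K1" for t
    using \<rho>(2) that interior_subset[of K] by blast
  show ?thesis
    unfolding collar_def
  proof (intro exI conjI ballI)
    show "0 < \<rho>" "K1 \<subseteq> K" using \<rho>(1) assms(2) interior_subset[of K] by auto
    fix t u assume tu: "t \<in> K1" "u \<in> X - K"
    then show "\<rho> \<le> norm (u - t)"
      using sub[OF tu(1)] by (force simp: dist_norm norm_minus_commute)
    then have "t + (\<rho> / norm (u - t)) *\<^sub>R (u - t) \<in> cball t \<rho>"
      using \<rho>(1) by (simp add: dist_norm)
    then show "t + (\<rho> / norm (u - t)) *\<^sub>R (u - t) \<in> K"
      using sub[OF tu(1)] by blast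
  qed
qed

text \<open>Points of the half-line outside \<open>K\<close> lie only to the right of
  \<open>b\<close>. So room is required on that side alone, and \<open>K1\<close> may contain the
  endpoint \<open>a\<close>: a move by \<open>b - b1\<close> from a point at most \<open>b1\<close>
  ends at most at \<open>b\<close>.\<close>

lemma collar_atLeast:
  assumes \<iota>: "real_identification \<iota>" and "b1 < b"
  shows "collar (\<iota> ` {a..}) (\<iota> ` {a..b}) (\<iota> ` {a..b1}) (b - b1)"
  unfolding collar_def
proof (intro conjI ballI)
  have l: "linear \<iota>" and n: "\<And>x. norm (\<iota> x) = \<bar>x\<bar>"
    using \<iota> by (auto simp: real_identification_def)
  show "0 < b - b1" "\<iota> ` {a..b1} \<subseteq> \<iota> ` {a..b}" using assms by auto
  fix t u assume "t \<in> \<iota> ` {a..b1}" "u \<in> \<iota> ` {a..} - \<iota> ` {a..b}"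
  then obtain x y where xy: "t = \<iota> x" "a \<le> x" "x \<le> b1" "u = \<iota> y" "b < y" by force
  have eq: "u - t = \<iota> (y - x)" using xy by (simp add: linear_diff[OF l])
  have "norm (u - t) = y - x" using xy assms eq by (simp add: n)
  then show "b - b1 \<le> norm (u - t)" using xy by simp
  have "t + ((b - b1) / norm (u - t)) *\<^sub>R (u - t) = \<iota> (x + (b - b1))"
    unfolding \<open>norm (u - t) = y - x\<close> unfolding eq linear_scale[OF l, symmetric]
    using xy assms by (simp add: linear_add[OF l])
  then show "t + ((b - b1) / norm (u - t)) *\<^sub>R (u - t) \<in> \<iota> ` {a..b}"
    using xy assms by auto
qed

text \<open>Composing the identification with the reflection at 0 turns this case into the previous
  one.\<close>

lemma collar_atMost:
  assumes \<iota>: "real_identification \<iota>" and "a < a1"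
  shows "collar (\<iota> ` {..b}) (\<iota> ` {a..b}) (\<iota> ` {a1..b}) (a1 - a)"
proof -
  have l: "linear \<iota>" and n: "\<And>x. norm (\<iota> x) = \<bar>x\<bar>" and s: "surj \<iota>"
    using \<iota> by (auto simp: real_identification_def)
  have "real_identification (\<lambda>x. \<iota> (- x))"
    unfolding real_identification_def
    using linear_compose[OF linear_uminus l] n s
    by (auto simp: o_def surj_def) (metis minus_minus)
  from collar_atLeast[OF this, of "- a1" "- a" "- b"] show ?thesis
    using assms(2) by (simp add: image_image[of \<iota> uminus, symmetric])
qed

section \<open>Growth of h outside K\<close>

text \<open>In \<open>g u = h_fun g g' t u + g t + g' t (u - t)\<close> the last two terms are at
  most a constant and a multiple of \<open>norm (u - t)\<close>. Both are absorbed by h, which is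
  bounded below and grows at least linearly beyond the collar.\<close>

lemma weight_le_h_fun:
  assumes g: "cond_g0 X K g g'" and K: "K \<subseteq> X" "compact K" and col: "collar X K K1 \<rho>"
  shows "\<exists>c>0. \<exists>C>0. \<forall>t\<in>K1. \<forall>u\<in>X - K. c \<le> h_fun g g' t u \<and> g u \<le> C * h_fun g g' t u"
proof -
  have g_cont: "continuous_on X g" and cvx: "strictly_convex_on X g"
    and deriv: "\<And>t. t \<in> K \<Longrightarrow> (g has_derivative blinfun_apply (g' t)) (at t within X)"
    and g'_cont: "continuous_on K g'"
    using g by (auto simp: cond_g0_def)
  note convex = strictly_convex_on_imp_convex_on[OF cvx]
  have \<rho>: "0 < \<rho>" "K1 \<subseteq> K" using col by (auto simp: collar_def)
  have gK: "continuous_on K g" using g_cont K continuous_on_subset by blast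
  define T where "T = {p \<in> K \<times> K. norm (snd p - fst p) = \<rho>}"
  have T: "compact T"
  proof -
    have "T = (K \<times> K) \<inter> {p. norm (snd p - fst p) = \<rho>}" by (auto simp: T_def)
    moreover have "closed {p::'a \<times> 'a. norm (snd p - fst p) = \<rho>}"
      by (intro closed_Collect_eq continuous_intros)
    ultimately show ?thesis using K by (simp add: compact_Times compact_Int_closed)
  qed
  \<comment> \<open>Pairs in \<open>T\<close> consist of distinct points because \<rho> is positive,
    so the minimum of h over the compact set \<open>T\<close> is positive. If \<open>T\<close> is
    empty, any positive value serves and 1 is taken.\<close>
  obtain c where c: "0 < c" "\<And>p. p \<in> T \<Longrightarrow> c \<le> h_fun g g' (fst p) (snd p)"
  proof (cases "T = {}")
    case False
    have "continuous_on T (\<lambda>p. h_fun g g' (fst p) (snd p))"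
      by (rule continuous_on_subset[OF continuous_on_h_fun[OF gK g'_cont]]) (auto simp: T_def)
    from continuous_attains_inf[OF T False this] obtain q
      where q: "q \<in> T" "\<forall>p\<in>T. h_fun g g' (fst q) (snd q) \<le> h_fun g g' (fst p) (snd p)" by blast
    have "0 < h_fun g g' (fst q) (snd q)"
      using q(1) K \<rho> by (intro h_fun_pos[OF cvx] deriv) (auto simp: T_def)
    then show ?thesis using that q by blast
  qed (use that[of 1] in auto)
  obtain G where G: "G > 0" "\<And>t. t \<in> K \<Longrightarrow> norm (g t) \<le> G"
    using compact_imp_bounded[OF compact_continuous_image[OF gK K(2)]]
    by (auto simp: bounded_pos)
  obtain G' where G': "G' > 0" "\<And>t. t \<in> K \<Longrightarrow> norm (g' t) \<le> G'"
    using compact_imp_bounded[OF compact_continuous_image[OF g'_cont K(2)]]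
    by (auto simp: bounded_pos)
  \<comment> \<open>The summands of the factor account for h itself, for \<open>g t\<close> through
    its bound \<open>G\<close>, and for the derivative term through \<open>G'\<close> and the bound
    on \<open>norm (u - t)\<close>.\<close>
  have "c \<le> h_fun g g' t u \<and> g u \<le> (1 + G / c + G' * \<rho> / c) * h_fun g g' t u"
    if t: "t \<in> K1" and u: "u \<in> X - K" for t u
  proof -
    have tK: "t \<in> K" using t \<rho> by auto
    define s where "s = \<rho> / norm (u - t)"
    have n: "\<rho> \<le> norm (u - t)" "t + s *\<^sub>R (u - t) \<in> K"
      using col t u by (auto simp: collar_def s_def)
    have pos: "0 < norm (u - t)" using n(1) \<rho>(1) by linarith
    have s: "0 < s" "s \<le> 1" unfolding s_def using n(1) \<rho>(1) pos by simp_all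
    have "norm (s *\<^sub>R (u - t)) = \<rho>" using \<rho>(1) pos by (simp add: s_def)
    then have "(t, t + s *\<^sub>R (u - t)) \<in> T" using n tK by (simp add: T_def)
    then have "c \<le> h_fun g g' t (t + s *\<^sub>R (u - t))" using c(2) by fastforce
    also have "\<dots> \<le> s * h_fun g g' t u"
      using s tK K u by (intro h_fun_convex[OF convex]) auto
    finally have *: "c \<le> s * h_fun g g' t u" .
    have h0: "0 \<le> h_fun g g' t u"
      using tK K u by (intro h_fun_nonneg[OF convex] deriv) auto
    have h1: "c \<le> h_fun g g' t u"
      using * mult_right_mono[OF s(2) h0] by simp
    \<comment> \<open>Multiplying the inequality for \<open>c\<close> by \<open>norm (u - t)\<close>
      replaces \<open>s\<close> by \<rho>.\<close>
    have nh: "norm (u - t) \<le> \<rho> / c * h_fun g g' t u"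
    proof -
      have "c * norm (u - t) \<le> s * h_fun g g' t u * norm (u - t)"
        using * pos by (intro mult_right_mono) auto
      then show ?thesis using pos c(1) by (simp add: s_def field_simps)
    qed
    have "g u = h_fun g g' t u + g t + g' t (u - t)" by (simp add: h_fun_def)
    also have "g t \<le> G / c * h_fun g g' t u"
    proof -
      have "g t \<le> G" using G(2)[OF tK] by simp
      also have "G \<le> G / c * h_fun g g' t u" using h1 c(1) G(1) by (simp add: field_simps)
      finally show ?thesis .
    qed
    also have "g' t (u - t) \<le> G' * norm (u - t)"
      using norm_blinfun[of "g' t" "u - t"] mult_right_mono[OF G'(2)[OF tK], of "norm (u - t)"]
      by simp
    also have "G' * norm (u - t) \<le> G' * (\<rho> / c * h_fun g g' t u)"
      using G' nh by (intro mult_left_mono) auto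
    finally show ?thesis using h1 by (simp add: algebra_simps)
  qed
  moreover have "0 < 1 + G / c + G' * \<rho> / c" using G G' c(1) \<rho> by (simp add: add_pos_pos)
  ultimately show ?thesis using c(1) by blast
qed

section \<open>Modulus of continuity and the pointwise bound\<close>

text \<open>A real \<open>Sup\<close> dominates the elements of its set once the set is bounded
  above; twice a bound of \<open>F\<close> on \<open>K\<close> is such an upper bound.\<close>

lemma modulus_on_upper:
  assumes "bounded (F ` K)" "t \<in> K" "u \<in> K" "norm (t - u) \<le> r"
  shows "norm (F u - F t) \<le> modulus_on K F r"
  unfolding modulus_on_def
proof (rule cSup_upper)
  obtain C where C: "\<And>x. x \<in> K \<Longrightarrow> norm (F x) \<le> C"
    using assms(1) by (auto simp: bounded_iff)
  show "bdd_above {norm (F u - F t) |t u. t \<in> K \<and> u \<in> K \<and> norm (t - u) \<le> r}"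
  proof (rule bdd_aboveI, clarify)
    fix x y assume "x \<in> K" "y \<in> K"
    then show "norm (F y - F x) \<le> C + C"
      using C norm_triangle_ineq4[of "F y" "F x"] by (meson add_mono order_trans)
  qed
qed (use assms in auto)

lemma modulus_on_nonneg:
  assumes "bounded (F ` K)" "t \<in> K" "0 \<le> r"
  shows "0 \<le> modulus_on K F r"
  using modulus_on_upper[OF assms(1,2,2), of r] assms(3) by simp

lemma modulus_on_0:
  assumes "t \<in> K"
  shows "modulus_on K F 0 = 0"
proof -
  have "{norm (F u - F t) |t u. t \<in> K \<and> u \<in> K \<and> norm (t - u) \<le> 0} = {0}"
    using assms by auto
  then show ?thesis by (simp add: modulus_on_def)
qed

text \<open>Serves the degenerate case \<gamma> = 0, in which the estimate is applied with
  arbitrarily small positive radii.\<close>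

lemma modulus_on_small:
  assumes "uniformly_continuous_on K F" "t \<in> K" "0 < e"
  shows "\<exists>d>0. modulus_on K F d \<le> e"
proof -
  obtain d where d: "d > 0" "\<And>x y. x \<in> K \<Longrightarrow> y \<in> K \<Longrightarrow> dist y x < d \<Longrightarrow> dist (F y) (F x) < e"
    using assms(1,3) unfolding uniformly_continuous_on_def by metis
  \<comment> \<open>The modulus admits distances equal to its radius while uniform continuity asks
    for strictly less than \<open>d\<close>, hence the half.\<close>
  have "modulus_on K F (d / 2) \<le> e"
    unfolding modulus_on_def
  proof (rule cSup_least)
    show "{norm (F u - F t) |t u. t \<in> K \<and> u \<in> K \<and> norm (t - u) \<le> d / 2} \<noteq> {}"
      using assms(2) d(1) by force
    fix z assume "z \<in> {norm (F u - F t) |t u. t \<in> K \<and> u \<in> K \<and> norm (t - u) \<le> d / 2}"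
    then obtain x y where "z = norm (F y - F x)" "x \<in> K" "y \<in> K" "norm (x - y) \<le> d / 2" by blast
    then show "z \<le> e"
      using d(2)[of x y] d(1) by (simp add: dist_norm norm_minus_commute)
  qed
  then show ?thesis using d(1) half_gt_zero by blast
qed

text \<open>Cut the segment from \<open>t\<close> to \<open>u\<close> into \<open>N\<close> equal
  pieces of length at most \<delta>. Convexity keeps the division points in \<open>K\<close>, so
  each piece costs at most one modulus.\<close>

lemma modulus_on_estimate:
  assumes "convex K" and bdd: "bounded (F ` K)" and tu: "t \<in> K" "u \<in> K" and "0 < \<delta>"
  shows "norm (F u - F t) \<le> modulus_on K F \<delta> * (1 + (norm (u - t))\<^sup>2 / \<delta>\<^sup>2)"
proof -
  define l where "l = norm (u - t) / \<delta>"
  \<comment> \<open>One piece suffices for \<open>l\<close> at most 1. Otherwise the ceiling of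
    \<open>l\<close> is below \<open>l + 1\<close>, and \<open>l\<close> is at most its
    square.\<close>
  obtain N :: nat where N: "0 < N" "l \<le> N" "N \<le> 1 + l\<^sup>2"
  proof (cases "l \<le> 1")
    case True
    then show ?thesis using that[of 1] by simp
  next
    case False
    have "real (nat \<lceil>l\<rceil>) < l + 1" using False by linarith
    moreover have "l \<le> l\<^sup>2" using False by (simp add: power2_eq_square)
    ultimately show ?thesis using that[of "nat \<lceil>l\<rceil>"] False by (simp add: real_nat_ceiling_ge)
  qed
  define p where "p i = t + (real i / real N) *\<^sub>R (u - t)" for i
  have p: "p i \<in> K" if "i \<le> N" for i
    using convexD_alt[OF assms(1) tu, of "real i / real N"] that N
    by (simp add: p_def algebra_simps)
  have "norm (F (p i) - F t) \<le> i * modulus_on K F \<delta>" if "i \<le> N" for i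
    using that
  proof (induction i)
    case (Suc i)
    have "p i - p (Suc i) = - (1 / real N) *\<^sub>R (u - t)"
      by (simp add: p_def add_divide_distrib algebra_simps)
    then have "norm (p i - p (Suc i)) = norm (u - t) / N" by simp
    also have "\<dots> \<le> \<delta>" using N assms(5) by (simp add: l_def field_simps)
    finally have "norm (F (p (Suc i)) - F (p i)) \<le> modulus_on K F \<delta>"
      using Suc.prems by (intro modulus_on_upper[OF bdd] p) auto
    with Suc show ?case
      using norm_diff_triangle_le[of "F (p (Suc i))" "F (p i)"] by (fastforce simp: algebra_simps)
  qed (simp add: p_def)
  from this[of N] have "norm (F u - F t) \<le> N * modulus_on K F \<delta>"
    using N by (simp add: p_def)
  also have "\<dots> \<le> (1 + l\<^sup>2) * modulus_on K F \<delta>"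
    using N modulus_on_nonneg[OF bdd tu(1), of \<delta>] assms(5) by (intro mult_right_mono) auto
  finally show ?thesis by (simp add: l_def power_divide mult.commute)
qed

text \<open>Both summands on the right are nonnegative, and each does the work alone in one region:
  the modulus for \<open>u\<close> in \<open>K\<close>, h for \<open>u\<close> outside
  \<open>K\<close>.\<close>

lemma pointwise_estimate:
  assumes g: "cond_g0 X K g g'" and K: "K \<subseteq> X" "compact K" "convex K"
    and col: "collar X K K1 \<rho>" and F: "F \<in> weighted_maps X g"
  shows "\<exists>M>0. \<forall>\<delta>>0. \<forall>t\<in>K1. \<forall>u\<in>X.
    norm (F u - F t) \<le> modulus_on K F \<delta> * (1 + (norm (u - t))\<^sup>2 / \<delta>\<^sup>2) + M * h_fun g g' t u"
proof -
  obtain c C where c: "c > 0" "C > 0"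
    and h: "\<And>t u. t \<in> K1 \<Longrightarrow> u \<in> X - K \<Longrightarrow> c \<le> h_fun g g' t u \<and> g u \<le> C * h_fun g g' t u"
    using weight_le_h_fun[OF g K(1,2) col] by blast
  obtain A where A: "A > 0" "\<And>u. u \<in> X \<Longrightarrow> norm (F u) \<le> A * g u"
    using F by (auto simp: weighted_maps_def)
  have "continuous_on K F"
    using F K(1) continuous_on_subset by (auto simp: weighted_maps_def continuous_maps_def)
  then have bdd: "bounded (F ` K)" using K(2) compact_continuous_image compact_imp_bounded by blast
  then obtain B where B: "B > 0" "\<And>u. u \<in> K \<Longrightarrow> norm (F u) \<le> B" by (auto simp: bounded_pos)
  \<comment> \<open>\<open>A * C\<close> pays for \<open>F u\<close> by way of
    \<open>A * g u\<close>, and \<open>B / c\<close> for \<open>F t\<close> by way of the lower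
    bound \<open>c\<close> of h.\<close>
  define M where "M = A * C + B / c"
  have "M > 0" using A B c by (simp add: M_def add_pos_pos)
  moreover have "norm (F u - F t)
      \<le> modulus_on K F \<delta> * (1 + (norm (u - t))\<^sup>2 / \<delta>\<^sup>2) + M * h_fun g g' t u"
    if "\<delta> > 0" and t: "t \<in> K1" and u: "u \<in> X" for \<delta> t u
  proof (cases "u \<in> K")
    case True
    have tK: "t \<in> K" using col t by (auto simp: collar_def)
    have "0 \<le> h_fun g g' t u"
      using g tK K(1) u
      by (intro h_fun_nonneg[of X] strictly_convex_on_imp_convex_on) (auto simp: cond_g0_def)
    then have "0 \<le> M * h_fun g g' t u" using \<open>M > 0\<close> by simp
    then show ?thesis using modulus_on_estimate[OF K(3) bdd tK True that(1)] by linarith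
  next
    case False
    have tK: "t \<in> K" using col t by (auto simp: collar_def)
    have h': "c \<le> h_fun g g' t u" "g u \<le> C * h_fun g g' t u" using h[OF t] u False by auto
    have "norm (F u - F t) \<le> A * g u + B"
      using norm_triangle_ineq4[of "F u" "F t"] A(2)[OF u] B(2)[OF tK] by linarith
    also have "A * g u \<le> A * (C * h_fun g g' t u)" using A(1) h'(2) by (intro mult_left_mono) auto
    also have "B \<le> B / c * h_fun g g' t u" using h'(1) c(1) B(1) by (simp add: field_simps)
    finally have "norm (F u - F t) \<le> M * h_fun g g' t u" by (simp add: M_def algebra_simps)
    moreover have "0 \<le> modulus_on K F \<delta> * (1 + (norm (u - t))\<^sup>2 / \<delta>\<^sup>2)"
      using modulus_on_nonneg[OF bdd tK, of \<delta>] that(1) by (simp add: add_nonneg_nonneg)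
    ultimately show ?thesis by linarith
  qed
  ultimately show ?thesis by blast
qed

section \<open>Closure properties of the weighted space\<close>

lemma restrict_in_weighted_maps_iff:
  "(\<lambda>u\<in>X. f u) \<in> weighted_maps X g \<longleftrightarrow>
    continuous_on X f \<and> (\<exists>M>0. \<forall>u\<in>X. norm (f u) \<le> M * g u)"
proof -
  have "continuous_on X (\<lambda>u\<in>X. f u) \<longleftrightarrow> continuous_on X f"
    by (rule continuous_on_cong) auto
  then show ?thesis by (simp add: weighted_maps_def continuous_maps_def)
qed

lemma weighted_maps_add:
  assumes "(\<lambda>u\<in>X. p u) \<in> weighted_maps X g" "(\<lambda>u\<in>X. q u) \<in> weighted_maps X g"
  shows "(\<lambda>u\<in>X. p u + q u) \<in> weighted_maps X g"
proof -
  from assms obtain M N where MN: "M > 0" "N > 0" "\<forall>u\<in>X. norm (p u) \<le> M * g u"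
    "\<forall>u\<in>X. norm (q u) \<le> N * g u" by (auto simp: restrict_in_weighted_maps_iff)
  have "\<forall>u\<in>X. norm (p u + q u) \<le> (M + N) * g u"
    unfolding distrib_right using MN(3,4) by (blast intro: norm_triangle_mono)
  then show ?thesis
    using assms add_pos_pos[OF MN(1,2)]
    unfolding restrict_in_weighted_maps_iff by (blast intro: continuous_on_add)
qed

lemma weighted_maps_scaleR:
  fixes p :: "'a::topological_space \<Rightarrow> 'e::real_normed_vector"
  assumes "(\<lambda>u\<in>X. p u) \<in> weighted_maps X g" "\<forall>u\<in>X. 0 < g u"
  shows "(\<lambda>u\<in>X. c *\<^sub>R p u) \<in> weighted_maps X g"
proof -
  from assms obtain M where M: "M > 0" "\<forall>u\<in>X. norm (p u) \<le> M * g u"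
    by (auto simp: restrict_in_weighted_maps_iff)
  \<comment> \<open>The 1 keeps the constant strictly positive when \<open>c\<close> is 0.\<close>
  have "norm (c *\<^sub>R p u) \<le> (\<bar>c\<bar> + 1) * M * g u" if "u \<in> X" for u
  proof -
    have "\<bar>c\<bar> * norm (p u) \<le> (\<bar>c\<bar> + 1) * (M * g u)"
      using M that by (intro mult_mono) auto
    then show ?thesis by (simp add: mult.assoc)
  qed
  moreover have "(\<bar>c\<bar> + 1) * M > 0" using M(1) by simp
  ultimately show ?thesis
    using assms(1) unfolding restrict_in_weighted_maps_iff
    by (intro conjI continuous_on_scaleR continuous_on_const) auto
qed

lemma weighted_maps_diff:
  fixes p q :: "'a::topological_space \<Rightarrow> 'e::real_normed_vector"
  assumes "(\<lambda>u\<in>X. p u) \<in> weighted_maps X g" "(\<lambda>u\<in>X. q u) \<in> weighted_maps X g" "\<forall>u\<in>X. 0 < g u"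
  shows "(\<lambda>u\<in>X. p u - q u) \<in> weighted_maps X g"
  using weighted_maps_add[OF assms(1) weighted_maps_scaleR[OF assms(2,3), of "-1"]] by simp

lemma weighted_maps_mono:
  assumes "(\<lambda>u\<in>X. q u) \<in> weighted_maps X g" "continuous_on X p" "\<And>u. u \<in> X \<Longrightarrow> norm (p u) \<le> norm (q u)"
  shows "(\<lambda>u\<in>X. p u) \<in> weighted_maps X g"
proof -
  obtain M where "M > 0" "\<forall>u\<in>X. norm (q u) \<le> M * g u"
    using assms(1) unfolding restrict_in_weighted_maps_iff by blast
  then have "\<forall>u\<in>X. norm (p u) \<le> M * g u" using assms(3) order_trans by blast
  with \<open>M > 0\<close> assms(2) show ?thesis unfolding restrict_in_weighted_maps_iff by blast
qed

text \<open>Condition \<open>cond_g1\<close> for n = 1 gives a set, compact by finite dimension,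
  outside which \<open>g\<close> is at least 1; on it the continuous positive \<open>g\<close>
  attains a positive minimum. This bound is what puts the constants into the weighted space.\<close>

lemma weight_bounded_below:
  assumes fin: "\<exists>B::'a::real_normed_vector set. finite B \<and> span B = UNIV"
    and g: "cond_g0 X K g g'" "cond_g1 (X::'a set) K g"
  shows "\<exists>c>0. \<forall>u\<in>X. c \<le> g u"
proof -
  obtain B where B: "closed B" "bounded B" "B \<subseteq> X" "\<forall>t\<in>X - B. 1 \<le> g t"
    using g(2) unfolding cond_g1_def by (metis le_refl of_nat_1)
  have "compact B" using compact_if_closed_bounded_finite_span[OF fin] B by blast
  show ?thesis
  proof (cases "B = {}")
    case True
    then show ?thesis using B(4) by (intro exI[of _ 1]) simp
  next
    case False
    have "continuous_on B g" using g(1) B(3) continuous_on_subset by (auto simp: cond_g0_def)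
    from continuous_attains_inf[OF \<open>compact B\<close> False this]
    obtain x where "x \<in> B" "\<forall>u\<in>B. g x \<le> g u" by blast
    moreover have "0 < g x" using g(1) B(3) \<open>x \<in> B\<close> by (auto simp: cond_g0_def)
    ultimately show ?thesis using B(4) by (intro exI[of _ "min 1 (g x)"]) (auto simp: min_le_iff_disj)
  qed
qed

lemma weighted_maps_const:
  assumes "c > 0" "\<forall>u\<in>X. c \<le> g u"
  shows "(\<lambda>u\<in>X. e) \<in> weighted_maps X g"
proof -
  have "norm e \<le> (norm e + 1) / c * g u" if "u \<in> X" for u
  proof -
    have "norm e * c \<le> (norm e + 1) * g u" using assms that by (intro mult_mono) auto
    then show ?thesis using assms(1) by (simp add: field_simps)
  qed
  moreover have "(norm e + 1) / c > 0" using assms(1) by (simp add: add_nonneg_pos)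
  ultimately show ?thesis by (auto simp: restrict_in_weighted_maps_iff)
qed

section \<open>Linear and dominated operators\<close>

text \<open>Additivity is assumed for members of \<open>D\<close>, whose sum carries nested
  restrictions; removing the inner ones gives a form usable for explicit lambda expressions.\<close>

lemma linear_operator_add:
  assumes "linear_operator X K D L" "(\<lambda>u\<in>X. p u) \<in> D" "(\<lambda>u\<in>X. q u) \<in> D" "t \<in> K"
  shows "L (\<lambda>u\<in>X. p u + q u) t = L (\<lambda>u\<in>X. p u) t + L (\<lambda>u\<in>X. q u) t"
proof -
  have "(\<lambda>u\<in>X. p u + q u) = (\<lambda>u\<in>X. (\<lambda>u\<in>X. p u) u + (\<lambda>u\<in>X. q u) u)" by (auto simp: fun_eq_iff)
  moreover have "L (\<lambda>u\<in>X. (\<lambda>u\<in>X. p u) u + (\<lambda>u\<in>X. q u) u) t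
      = L (\<lambda>u\<in>X. p u) t + L (\<lambda>u\<in>X. q u) t"
    using assms unfolding linear_operator_def by blast
  ultimately show ?thesis by simp
qed

lemma linear_operator_scaleR:
  assumes "linear_operator X K D L" "(\<lambda>u\<in>X. p u) \<in> D" "t \<in> K"
  shows "L (\<lambda>u\<in>X. c *\<^sub>R p u) t = c *\<^sub>R L (\<lambda>u\<in>X. p u) t"
proof -
  have "(\<lambda>u\<in>X. c *\<^sub>R p u) = (\<lambda>u\<in>X. c *\<^sub>R (\<lambda>u\<in>X. p u) u)" by (auto simp: fun_eq_iff)
  moreover have "L (\<lambda>u\<in>X. c *\<^sub>R (\<lambda>u\<in>X. p u) u) t = c *\<^sub>R L (\<lambda>u\<in>X. p u) t"
    using assms unfolding linear_operator_def by blast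
  ultimately show ?thesis by simp
qed

lemma linear_operator_diff:
  assumes L: "linear_operator X K D L" and D: "(\<lambda>u\<in>X. p u) \<in> D" "(\<lambda>u\<in>X. q u) \<in> D" and "t \<in> K"
  shows "L (\<lambda>u\<in>X. p u - q u) t = L (\<lambda>u\<in>X. p u) t - L (\<lambda>u\<in>X. q u) t"
proof -
  have "(\<lambda>u\<in>X. - 1 *\<^sub>R q u) = (\<lambda>u\<in>X. - 1 *\<^sub>R (\<lambda>u\<in>X. q u) u)" by (auto simp: fun_eq_iff)
  then have "(\<lambda>u\<in>X. - 1 *\<^sub>R q u) \<in> D"
    using L D(2) unfolding linear_operator_def map_subspace_def by metis
  from linear_operator_add[OF L D(1) this \<open>t \<in> K\<close>] linear_operator_scaleR[OF L D(2) \<open>t \<in> K\<close>, of "-1"]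
  show ?thesis by simp
qed

text \<open>Carries a pointwise bound over to the operators, with \<open>p\<close> and
  \<open>q\<close> standing for the squared distance and h. The constant is written
  \<open>A * 1\<close> so that all three terms are multiples of fixed functions on which
  \<open>S\<close> is evaluated.\<close>

lemma dominated_pair_estimate:
  fixes F :: "'a::topological_space \<Rightarrow> 'e::real_normed_vector"
  assumes dom: "dominated_pair X K g DL L DS S" and g: "\<forall>u\<in>X. 0 < g u" and t: "t \<in> K"
    and F: "F \<in> weighted_maps X g" and e: "(\<lambda>u\<in>X. e) \<in> weighted_maps X g"
    and W: "(\<lambda>u\<in>X. 1::real) \<in> weighted_maps X g" "(\<lambda>u\<in>X. p u) \<in> weighted_maps X g"
      "(\<lambda>u\<in>X. q u) \<in> weighted_maps X g"
    and le: "\<And>u. u \<in> X \<Longrightarrow> norm (F u - e) \<le> A * 1 + B * p u + M * q u"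
  shows "norm (L F t - L (\<lambda>u\<in>X. e) t)
    \<le> A * S (\<lambda>u\<in>X. 1) t + B * S (\<lambda>u\<in>X. p u) t + M * S (\<lambda>u\<in>X. q u) t"
proof -
  have L: "linear_operator X K DL L" and S: "linear_operator X K DS S"
    and WL: "weighted_maps X g \<subseteq> DL" and WS: "weighted_maps X g \<subseteq> DS"
    and pos: "positive_operator X K DS S" and d: "dominated_by X K DL L DS S"
    using dom by (auto simp: dominated_pair_def)
  \<comment> \<open>Members of the weighted space are extensional, so \<open>F\<close> equals its
    restriction and the rules for restricted lambda expressions apply.\<close>
  have F': "(\<lambda>u\<in>X. F u) = F"
    using F by (auto simp: weighted_maps_def continuous_maps_def extensional_restrict)
  have FW: "(\<lambda>u\<in>X. F u) \<in> weighted_maps X g" using F F' by simp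
  have DW: "(\<lambda>u\<in>X. F u - e) \<in> weighted_maps X g" by (rule weighted_maps_diff[OF FW e g])
  have NW: "(\<lambda>u\<in>X. norm (F u - e)) \<in> weighted_maps X g"
    using DW unfolding restrict_in_weighted_maps_iff
    by (simp only: norm_ge_zero real_norm_def abs_norm_cancel continuous_on_norm)
  note scale = weighted_maps_scaleR[OF _ g, where 'e = real, unfolded real_scaleR_def]
  note W1 = scale[OF W(1), of A] and W2 = scale[OF W(2), of B] and W3 = scale[OF W(3), of M]
  note W12 = weighted_maps_add[OF W1 W2]
  note W123 = weighted_maps_add[OF W12 W3]
  note DS = subsetD[OF WS]
  have "L F t - L (\<lambda>u\<in>X. e) t = L (\<lambda>u\<in>X. F u - e) t"
    using linear_operator_diff[OF L subsetD[OF WL FW] subsetD[OF WL e] t] F' by simp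
  also have "norm \<dots> \<le> S (\<lambda>u\<in>X. norm ((\<lambda>u\<in>X. F u - e) u)) t"
    using d DW WL t unfolding dominated_by_def by blast
  also have "(\<lambda>u\<in>X. norm ((\<lambda>u\<in>X. F u - e) u)) = (\<lambda>u\<in>X. norm (F u - e))" by (auto simp: fun_eq_iff)
  \<comment> \<open>Monotonicity of \<open>S\<close> is positivity applied to the difference of the
    two functions, which again lies in the weighted space.\<close>
  also have "S (\<lambda>u\<in>X. norm (F u - e)) t \<le> S (\<lambda>u\<in>X. A * 1 + B * p u + M * q u) t"
  proof -
    have "(\<lambda>u\<in>X. (A * 1 + B * p u + M * q u) - norm (F u - e)) \<in> DS"
      by (rule DS[OF weighted_maps_diff[OF W123 NW g]])
    then have "0 \<le> S (\<lambda>u\<in>X. (A * 1 + B * p u + M * q u) - norm (F u - e)) t"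
      using pos t le unfolding positive_operator_def by simp
    then show ?thesis
      using linear_operator_diff[OF S DS[OF W123] DS[OF NW] t] by simp
  qed
  also have "\<dots> = S (\<lambda>u\<in>X. A * 1) t + S (\<lambda>u\<in>X. B * p u) t + S (\<lambda>u\<in>X. M * q u) t"
    using linear_operator_add[OF S DS[OF W12] DS[OF W3] t]
      linear_operator_add[OF S DS[OF W1] DS[OF W2] t] by simp
  also have "\<dots> = A * S (\<lambda>u\<in>X. 1) t + B * S (\<lambda>u\<in>X. p u) t + M * S (\<lambda>u\<in>X. q u) t"
    using linear_operator_scaleR[OF S DS[OF W(1)] t, of A]
      linear_operator_scaleR[OF S DS[OF W(2)] t, of B]
      linear_operator_scaleR[OF S DS[OF W(3)] t, of M] by simp
  finally show ?thesis .
qed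

section \<open>Distances as weighted maps\<close>

text \<open>Passing from one centre \<open>s\<close> to any centre \<open>t\<close> costs only a
  constant and a factor 2, by the triangle inequality and
  \<open>2 * a * b \<le> a * a + b * b\<close>.\<close>

lemma weighted_maps_norm_diff:
  assumes c: "c > 0" "\<forall>u\<in>X. c \<le> g u" and g: "\<forall>u\<in>X. 0 < g u"
    and psi: "(\<lambda>u\<in>X. (norm (u - s))\<^sup>2) \<in> weighted_maps X g"
  shows "(\<lambda>u\<in>X. norm (u - t)) \<in> weighted_maps X g"
    and "(\<lambda>u\<in>X. (norm (u - t))\<^sup>2) \<in> weighted_maps X g"
proof -
  have sum: "(\<lambda>u\<in>X. (1 + 2 * (norm (s - t))\<^sup>2) + 2 *\<^sub>R (norm (u - s))\<^sup>2) \<in> weighted_maps X g"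
    by (intro weighted_maps_add weighted_maps_const[OF c] weighted_maps_scaleR[OF psi g])
  have sq: "(norm (u - t))\<^sup>2 \<le> (1 + 2 * (norm (s - t))\<^sup>2) + 2 * (norm (u - s))\<^sup>2" for u
  proof -
    have "norm (u - t) \<le> norm (u - s) + norm (s - t)"
      using norm_triangle_ineq[of "u - s" "s - t"] by simp
    then have "(norm (u - t))\<^sup>2 \<le> (norm (u - s) + norm (s - t))\<^sup>2" by (rule power_mono) simp
    also have "\<dots> \<le> (1 + 2 * (norm (s - t))\<^sup>2) + 2 * (norm (u - s))\<^sup>2"
      using zero_le_power2[of "norm (u - s) - norm (s - t)"]
      by (simp add: power2_eq_square algebra_simps)
    finally show ?thesis .
  qed
  show sq_norm: "(\<lambda>u\<in>X. (norm (u - t))\<^sup>2) \<in> weighted_maps X g"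
    by (rule weighted_maps_mono[OF sum])
      (use sq in \<open>auto intro!: continuous_intros simp: add_nonneg_nonneg\<close>)
  \<comment> \<open>The square of \<open>norm (u - t) - 1/2\<close> is nonnegative, so the first
    power is at most the square plus 1/4.\<close>
  have *: "norm (u - t) \<le> 1 + 1 *\<^sub>R (norm (u - t))\<^sup>2" for u
    using zero_le_power2[of "norm (u - t) - 1/2"] by (simp add: power2_eq_square algebra_simps)
  have "(\<lambda>u\<in>X. 1 + 1 *\<^sub>R (norm (u - t))\<^sup>2) \<in> weighted_maps X g"
    by (intro weighted_maps_add weighted_maps_const[OF c] weighted_maps_scaleR[OF sq_norm g])
  then show "(\<lambda>u\<in>X. norm (u - t)) \<in> weighted_maps X g"
    by (rule weighted_maps_mono) (use * in \<open>auto intro!: continuous_intros simp: add_nonneg_nonneg\<close>)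
qed

section \<open>The quantitative estimates for dominated operators\<close>

theorem theorem4p5:
  fixes X K K1 :: "('z::real_normed_vector \<Rightarrow>\<^sub>L real) set"
    and g :: "('z \<Rightarrow>\<^sub>L real) \<Rightarrow> real"
    and g' :: "('z \<Rightarrow>\<^sub>L real) \<Rightarrow> ('z \<Rightarrow>\<^sub>L real) \<Rightarrow>\<^sub>L real"
    and F :: "('z \<Rightarrow>\<^sub>L real) \<Rightarrow> 'e::real_normed_vector"
  assumes fin_dim: "\<exists>B :: ('z \<Rightarrow>\<^sub>L real) set. finite B \<and> span B = UNIV"
    and X: "convex X" "(closed X \<and> \<not> bounded X) \<or> open X"
    and K: "K \<subseteq> X" "closed K" "bounded K"
    and g: "cond_g0 X K g g'" "cond_g1 X K g"
    and psi: "\<exists>t. (\<lambda>u\<in>X. (norm (u - t))\<^sup>2) \<in> weighted_maps X g"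
    and cases:
      "(convex K \<and> closed K1 \<and> K1 \<subseteq> interior K)
       \<or> (\<exists>\<iota> a b b1. real_identification \<iota> \<and> X = \<iota> ` {a..} \<and> K = \<iota> ` {a..b} \<and>
            b1 < b \<and> K1 = \<iota> ` {a..b1})
       \<or> (\<exists>\<iota> a b a1. real_identification \<iota> \<and> X = \<iota> ` {..b} \<and> K = \<iota> ` {a..b} \<and>
            a < a1 \<and> K1 = \<iota> ` {a1..b})"
    and F: "F \<in> weighted_maps X g"
  shows "\<exists>M>0. \<forall>(DL :: nat \<Rightarrow> (('z \<Rightarrow>\<^sub>L real) \<Rightarrow> 'e) set) L DS S.
    (\<forall>n\<ge>1. dominated_pair X K g (DL n) (L n) (DS n) (S n)) \<longrightarrow>
    (\<forall>n\<ge>1. \<forall>t\<in>K1.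
       let psi2 = (\<lambda>u\<in>X. (norm (u - t))\<^sup>2);
           \<gamma> = sqrt (S n psi2 t)
       in
         (\<forall>\<delta>>0. norm (L n F t - F t)
            \<le> norm (L n (\<lambda>u\<in>X. F t) t - F t)
               + modulus_on K F \<delta> * (S n (\<lambda>u\<in>X. 1) t + S n psi2 t / \<delta>\<^sup>2)
               + M * S n (\<lambda>u\<in>X. h_fun g g' t u) t)
         \<and> (preserves_constants X K (DL n) (L n) \<and> S n (\<lambda>u\<in>X. 1) t = 1 \<longrightarrow>
              norm (L n F t - F t)
                \<le> 2 * modulus_on K F \<gamma> + M * S n (\<lambda>u\<in>X. h_fun g g' t u) t)
         \<and> (preserves_constants X K (DL n) (L n) \<and> S n (\<lambda>u\<in>X. 1) t = 1 \<and>
            (\<forall>\<phi>. linear \<phi> \<longrightarrow> S n (\<lambda>u\<in>X. \<phi> u) t = \<phi> t) \<longrightarrow>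
              norm (L n F t - F t)
                \<le> 2 * modulus_on K F \<gamma> + M * (S n (\<lambda>u\<in>X. g u) t - g t)))"
proof -
  have g_pos: "\<forall>u\<in>X. 0 < g u" and g_cont: "continuous_on X g" using g(1) by (auto simp: cond_g0_def)
  have K_compact: "compact K" by (rule compact_if_closed_bounded_finite_span[OF fin_dim K(2,3)])
  \<comment> \<open>All three cases reduce to a collar and the convexity of \<open>K\<close>; in the
    two half-line cases \<open>K\<close> is a linear image of an interval.\<close>
  obtain \<rho> where col: "collar X K K1 \<rho>" and "convex K"
  proof -
    have lin: "linear \<iota>" if "real_identification \<iota>" for \<iota> :: "real \<Rightarrow> 'z \<Rightarrow>\<^sub>L real"
      using that by (simp add: real_identification_def)
    show ?thesis
      using cases
    proof (elim disjE exE conjE)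
      assume *: "convex K" "closed K1" "K1 \<subseteq> interior K"
      then have "compact K1"
        using K_compact interior_subset[of K] by (metis compact_Int_closed inf.absorb_iff2 order_trans)
      then show ?thesis using that collar_interior * by blast
    next
      fix \<iota> a b b1
      assume *: "real_identification \<iota>" "X = \<iota> ` {a..}" "K = \<iota> ` {a..b}" "b1 < b" "K1 = \<iota> ` {a..b1}"
      show ?thesis
        by (rule that[of "b - b1"])
          (use * in \<open>simp_all add: collar_atLeast convex_linear_image lin\<close>)
    next
      fix \<iota> a b a1
      assume *: "real_identification \<iota>" "X = \<iota> ` {..b}" "K = \<iota> ` {a..b}" "a < a1" "K1 = \<iota> ` {a1..b}"
      show ?thesis
        by (rule that[of "a1 - a"])
          (use * in \<open>simp_all add: collar_atMost convex_linear_image lin\<close>)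
    qed
  qed
  have K1: "K1 \<subseteq> K" using col by (simp add: collar_def)
  obtain c where c: "c > 0" "\<forall>u\<in>X. c \<le> g u" using weight_bounded_below[OF fin_dim g] by blast
  obtain s where s: "(\<lambda>u\<in>X. (norm (u - s))\<^sup>2) \<in> weighted_maps X g" using psi by blast
  note const = weighted_maps_const[OF c]
  note psi2 = weighted_maps_norm_diff(2)[OF c g_pos s]
  \<comment> \<open>A bounded functional is dominated by its norm times the distance to 0.\<close>
  have functional: "(\<lambda>u\<in>X. blinfun_apply \<phi> u) \<in> weighted_maps X g"
    for \<phi> :: "('z \<Rightarrow>\<^sub>L real) \<Rightarrow>\<^sub>L real"
    by (rule weighted_maps_mono[OF weighted_maps_scaleR[OF
            weighted_maps_norm_diff(1)[OF c g_pos s, of 0] g_pos, of "norm \<phi>"]])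
      (use norm_blinfun[of \<phi>] in \<open>auto intro!: continuous_intros simp: abs_mult\<close>)
  have gW: "(\<lambda>u\<in>X. g u) \<in> weighted_maps X g"
    unfolding restrict_in_weighted_maps_iff using g_cont g_pos
    by (intro conjI exI[of _ 1]) (auto intro: less_imp_le)
  \<comment> \<open>Weight minus functional minus constant: this form gives both the membership of h
    in the weighted space and the value of \<open>S\<close> on h in the last estimate.\<close>
  have h_eq: "h_fun g g' t u = g u - blinfun_apply (g' t) u - (g t - blinfun_apply (g' t) t)" for t u
    by (simp add: h_fun_def blinfun.diff_right)
  have hW: "(\<lambda>u\<in>X. h_fun g g' t u) \<in> weighted_maps X g" for t
    unfolding h_eq by (intro weighted_maps_diff gW functional const g_pos)
  have F_unif: "uniformly_continuous_on K F"
    using F K(1) continuous_on_subset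
    by (intro compact_uniformly_continuous K_compact) (auto simp: weighted_maps_def continuous_maps_def)
  have F_bdd: "bounded (F ` K)"
    by (intro compact_imp_bounded compact_continuous_image K_compact
        uniformly_continuous_imp_continuous F_unif)
  \<comment> \<open>\<open>M\<close> is fixed before any operator is introduced, hence independent
    of the operators, n, \<delta> and \<open>t\<close>.\<close>
  obtain M where M: "M > 0"
    and ptw: "\<And>\<delta> t u. \<delta> > 0 \<Longrightarrow> t \<in> K1 \<Longrightarrow> u \<in> X \<Longrightarrow> norm (F u - F t)
      \<le> modulus_on K F \<delta> * (1 + (norm (u - t))\<^sup>2 / \<delta>\<^sup>2) + M * h_fun g g' t u"
    using pointwise_estimate[OF g(1) K(1) K_compact \<open>convex K\<close> col F] by blast
  show ?thesis
  proof (intro exI[of _ M] conjI M allI impI ballI)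
    fix DL :: "nat \<Rightarrow> (('z \<Rightarrow>\<^sub>L real) \<Rightarrow> 'e) set" and L and DS
      and S :: "nat \<Rightarrow> (('z \<Rightarrow>\<^sub>L real) \<Rightarrow> real) \<Rightarrow> ('z \<Rightarrow>\<^sub>L real) \<Rightarrow> real"
      and n :: nat and t
    assume dp: "\<forall>n\<ge>1. dominated_pair X K g (DL n) (L n) (DS n) (S n)" and n: "1 \<le> n" and t: "t \<in> K1"
    define P where "P = S n (\<lambda>u\<in>X. (norm (u - t))\<^sup>2) t"
    define H where "H = S n (\<lambda>u\<in>X. h_fun g g' t u) t"
    have dom: "dominated_pair X K g (DL n) (L n) (DS n) (S n)" using dp n by blast
    then have S: "linear_operator X K (DS n) (S n)" and DS: "weighted_maps X g \<subseteq> DS n"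
      and pos: "positive_operator X K (DS n) (S n)"
      by (auto simp: dominated_pair_def)
    have tK: "t \<in> K" using t K1 by blast
    \<comment> \<open>This makes \<gamma> a genuine square root, with square
      \<open>P\<close>.\<close>
    have "0 \<le> P"
      using pos subsetD[OF DS psi2[of t]] tK unfolding positive_operator_def P_def by simp
    have main: "norm (L n F t - F t) \<le> norm (L n (\<lambda>u\<in>X. F t) t - F t)
        + modulus_on K F \<delta> * (S n (\<lambda>u\<in>X. 1) t + P / \<delta>\<^sup>2) + M * H" if "\<delta> > 0" for \<delta>
    proof -
      have "norm (L n F t - L n (\<lambda>u\<in>X. F t) t) \<le> modulus_on K F \<delta> * S n (\<lambda>u\<in>X. 1) t
          + modulus_on K F \<delta> / \<delta>\<^sup>2 * P + M * H"
        unfolding P_def H_def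
        by (rule dominated_pair_estimate[OF dom g_pos tK F const const psi2 hW])
          (use ptw[OF that t] in \<open>simp add: algebra_simps\<close>)
      moreover have "norm (L n F t - F t)
          \<le> norm (L n F t - L n (\<lambda>u\<in>X. F t) t) + norm (L n (\<lambda>u\<in>X. F t) t - F t)"
        using norm_triangle_ineq[of "L n F t - L n (\<lambda>u\<in>X. F t) t" "L n (\<lambda>u\<in>X. F t) t - F t"]
        by simp
      ultimately show ?thesis by (simp add: algebra_simps)
    qed
    have second: "norm (L n F t - F t) \<le> 2 * modulus_on K F (sqrt P) + M * H"
      if pc: "preserves_constants X K (DL n) (L n)" and S1: "S n (\<lambda>u\<in>X. 1) t = 1"
    proof -
      have "L n (\<lambda>u\<in>X. F t) t = F t" using pc tK by (simp add: preserves_constants_def)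
      then have est: "norm (L n F t - F t) \<le> modulus_on K F \<delta> * (1 + P / \<delta>\<^sup>2) + M * H"
        if "\<delta> > 0" for \<delta> using main[OF that] S1 by simp
      \<comment> \<open>For positive \<open>P\<close> the choice of \<open>sqrt P\<close> as
        \<delta> turns the factor into 2. For \<open>P = 0\<close> that choice is not admissible;
        instead \<delta> is made small until the modulus is below any \<open>e\<close>, which leaves
        only \<open>M * H\<close>.\<close>
      show ?thesis
      proof (cases "P = 0")
        case False
        then show ?thesis using est[of "sqrt P"] \<open>0 \<le> P\<close> by simp
      next
        case True
        have "norm (L n F t - F t) \<le> M * H"
        proof (rule field_le_epsilon)
          fix e :: real assume "0 < e"
          then obtain d where "d > 0" "modulus_on K F d \<le> e"
            using modulus_on_small[OF F_unif tK] by blast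
          then show "norm (L n F t - F t) \<le> M * H + e" using est[of d] True by simp
        qed
        then show ?thesis using True by (simp add: modulus_on_0[OF tK])
      qed
    qed
    \<comment> \<open>Under \<open>S\<close> the functional \<open>g' t\<close> and the constant in
      h keep their values at \<open>t\<close>, so the terms \<open>g' t t\<close> cancel.\<close>
    have third: "H = S n (\<lambda>u\<in>X. g u) t - g t"
      if S1: "S n (\<lambda>u\<in>X. 1) t = 1" and lin: "\<forall>\<phi>. linear \<phi> \<longrightarrow> S n (\<lambda>u\<in>X. \<phi> u) t = \<phi> t"
    proof -
      note D = subsetD[OF DS]
      note gl = weighted_maps_diff[OF gW functional g_pos]
      let ?k = "g t - blinfun_apply (g' t) t"
      have "S n (\<lambda>u\<in>X. ?k *\<^sub>R 1) t = ?k"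
        using linear_operator_scaleR[OF S D[OF const] tK, of ?k 1] S1 by simp
      moreover have "H = S n (\<lambda>u\<in>X. g u - blinfun_apply (g' t) u) t - S n (\<lambda>u\<in>X. ?k) t"
        unfolding H_def h_eq by (rule linear_operator_diff[OF S D[OF gl] D[OF const] tK])
      moreover have "S n (\<lambda>u\<in>X. g u - blinfun_apply (g' t) u) t = S n (\<lambda>u\<in>X. g u) t - g' t t"
        using linear_operator_diff[OF S D[OF gW] D[OF functional] tK, of "g' t"] lin
        by (simp add: blinfun.bounded_linear_right bounded_linear.linear)
      ultimately show ?thesis by simp
    qed
    show "let psi2 = (\<lambda>u\<in>X. (norm (u - t))\<^sup>2); \<gamma> = sqrt (S n psi2 t)
       in (\<forall>\<delta>>0. norm (L n F t - F t)
            \<le> norm (L n (\<lambda>u\<in>X. F t) t - F t)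
               + modulus_on K F \<delta> * (S n (\<lambda>u\<in>X. 1) t + S n psi2 t / \<delta>\<^sup>2)
               + M * S n (\<lambda>u\<in>X. h_fun g g' t u) t)
         \<and> (preserves_constants X K (DL n) (L n) \<and> S n (\<lambda>u\<in>X. 1) t = 1 \<longrightarrow>
              norm (L n F t - F t)
                \<le> 2 * modulus_on K F \<gamma> + M * S n (\<lambda>u\<in>X. h_fun g g' t u) t)
         \<and> (preserves_constants X K (DL n) (L n) \<and> S n (\<lambda>u\<in>X. 1) t = 1 \<and>
            (\<forall>\<phi>. linear \<phi> \<longrightarrow> S n (\<lambda>u\<in>X. \<phi> u) t = \<phi> t) \<longrightarrow>
              norm (L n F t - F t)
                \<le> 2 * modulus_on K F \<gamma> + M * (S n (\<lambda>u\<in>X. g u) t - g t))"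
      unfolding Let_def P_def[symmetric] H_def[symmetric]
      using main second third by (intro conjI allI impI) auto
  qed
qed

end
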